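(* Let $W$ be a discrete channel that is strongly symmetric, i.e. in its transition probability matrix each row is a permutation of every other row and each column is a permutation of every other column. Then $(W,R)$ is pseudo-symmetric for any $R\in(0,I(X;Y))$. Furthermore, $W$ is $h$-lattice if and only if $(W,R)$ is $(\eta h,a)$-lattice for some $a\in\mathbb R$.
   Context: Fix an input distribution $P_X$ on the input alphabet. Let $X\sim P_X$, let $Y$ be the output of the channel $W(\cdot|X)$ given $X$, and let $X'\sim P_X$ be independent of $(X,Y)$. Put $\nu(X,Y,x')=\log\frac{W(Y|x')}{W(Y|X)}\in[-\infty,\infty)$ and, for $\lambda>0$, $Z(\lambda)=\log \mathrm E_{X'}[e^{\lambda\nu(X,Y,X')}]$ (a random variable depending on $(X,Y)$, with $e^{\lambda(-\infty)}=0$), with derivative $Z'(\lambda)$ in $\lambda$; $\mathrm E_{X'}$ is the expectation over $X'$ for given $(X,Y)$. $I(X;Y)$ is the mutual information, assumed finite. For $0<R<I(X;Y)$ let $\rho$ be the minimizer of $\alpha R+\log \mathrm E[e^{\alpha Z(1/(1+\alpha))}]$ over $\alpha\in(0,1]$ and $\eta=1/(1+\rho)$. A random variable $V\in\mathbb R\cup\{-\infty\}$ that is not supported on $\{-\infty,v\}$ for a single $v\in\mathbb R$ has a lattice distribution with span $h>0$ and offset $a\in\mathbb R$ if $V\in\{a+ih:i\in\mathbb Z\}\cup\{-\infty\}$ a.s. and $h$ is the largest number with this property. $W$ is $h$-lattice if $\nu(X,Y,X')$ has a lattice distribution with span $h$ (so $h>0$). The pair $(W,R)$ is $(h',a')$-lattice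 if $Z(\eta)$ has a lattice distribution with span $h'$ and offset $a'$. $(W,R)$ is pseudo-symmetric if $(Z(\eta),Z'(\eta))$ is distributed over a single line, i.e. $Z'(\eta)$ is a linear (affine) function of $Z(\eta)$.
   Formalization: The input distribution P_X is taken to be uniform; for arbitrary P_X the claim fails, e.g. for the binary symmetric channel with crossover 0.1 and P_X = (0.3, 0.7), where (Z(η), Z'(η)) lies on two distinct parallel lines. *)

theory Defs
  imports "HOL-Probability.Probability"
begin

text \<open>
  A discrete channel is a map \<open>W :: 'x::finite \<Rightarrow> 'y::finite pmf\<close>; its transition probability
  matrix has the entry \<open>pmf (W x) y\<close> in row \<open>x\<close> and column \<open>y\<close>.
\<close>

definition strongly_symmetric :: "('x::finite \<Rightarrow> 'y::finite pmf) \<Rightarrow> bool" where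
  "strongly_symmetric W \<longleftrightarrow>
     (\<forall>x1 x2. \<exists>\<pi>. bij \<pi> \<and> (\<forall>y. pmf (W x2) y = pmf (W x1) (\<pi> y))) \<and>
     (\<forall>y1 y2. \<exists>\<pi>. bij \<pi> \<and> (\<forall>x. pmf (W x) y2 = pmf (W (\<pi> x)) y1))"

definition channel_joint :: "'x pmf \<Rightarrow> ('x \<Rightarrow> 'y pmf) \<Rightarrow> ('x \<times> 'y) pmf" where
  "channel_joint P W = bind_pmf P (\<lambda>x. map_pmf (Pair x) (W x))"

text \<open>
  In \<open>pair_pmf (channel_joint P W) P\<close>, a distribution on triples \<open>((x, y), x')\<close>, the last
  component is an independent copy of the input.
  All logarithms are natural, so mutual information is taken with base \<open>exp 1\<close>.
\<close>

definition channel_information :: "'x::finite pmf \<Rightarrow> ('x \<Rightarrow> 'y::finite pmf) \<Rightarrow> real" where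
  "channel_information P W =
     prob_space.mutual_information (measure_pmf (channel_joint P W)) (exp 1)
       (count_space UNIV) (count_space UNIV) fst snd"

text \<open>
  The case distinction is needed because \<open>ln 0 = 0\<close> for real numbers.  Where \<open>pmf (W x) y = 0\<close>
  the value is irrelevant: such \<open>(x, y)\<close> have probability zero.
\<close>

definition nu :: "('x \<Rightarrow> 'y pmf) \<Rightarrow> 'x \<Rightarrow> 'y \<Rightarrow> 'x \<Rightarrow> ereal" where
  "nu W x y x' =
     (if pmf (W x') y = 0 then -\<infinity> else ereal (ln (pmf (W x') y / pmf (W x) y)))"

text \<open>
  Exponential on \<open>[-\<infinity>, \<infinity>)\<close>; the value at \<open>\<infinity>\<close> is a dummy, as \<open>nu\<close> never takes it.
\<close>

definition exp_ext :: "ereal \<Rightarrow> real" where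
  "exp_ext v = (if v = -\<infinity> then 0 else exp (real_of_ereal v))"

text \<open>
  \<open>Z\<close> can be real-valued: almost surely both \<open>P\<close> charges \<open>x\<close> and \<open>pmf (W x) y > 0\<close>, so that the
  term \<open>x' = x\<close> makes the expectation strictly positive.
\<close>

definition Z :: "'x pmf \<Rightarrow> ('x \<Rightarrow> 'y pmf) \<Rightarrow> real \<Rightarrow> 'x \<Rightarrow> 'y \<Rightarrow> real" where
  "Z P W l x y =
     ln (measure_pmf.expectation P (\<lambda>x'. exp_ext (ereal l * nu W x y x')))"

definition Z' :: "'x pmf \<Rightarrow> ('x \<Rightarrow> 'y pmf) \<Rightarrow> real \<Rightarrow> 'x \<Rightarrow> 'y \<Rightarrow> real" where
  "Z' P W l x y = deriv (\<lambda>t. Z P W t x y) l"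

definition rate_objective :: "'x pmf \<Rightarrow> ('x \<Rightarrow> 'y pmf) \<Rightarrow> real \<Rightarrow> real \<Rightarrow> real" where
  "rate_objective P W R \<alpha> =
     \<alpha> * R + ln (measure_pmf.expectation (channel_joint P W)
                   (\<lambda>(x, y). exp (\<alpha> * Z P W (1 / (1 + \<alpha>)) x y)))"

definition rho :: "'x pmf \<Rightarrow> ('x \<Rightarrow> 'y pmf) \<Rightarrow> real \<Rightarrow> real" where
  "rho P W R = arg_min_on (rate_objective P W R) {0<..1}"

definition eta :: "'x pmf \<Rightarrow> ('x \<Rightarrow> 'y pmf) \<Rightarrow> real \<Rightarrow> real" where
  "eta P W R = 1 / (1 + rho P W R)"

definition on_lattice :: "'a measure \<Rightarrow> ('a \<Rightarrow> ereal) \<Rightarrow> real \<Rightarrow> real \<Rightarrow> bool" where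
  "on_lattice M V h a \<longleftrightarrow>
     (AE \<omega> in M. V \<omega> \<in> insert (-\<infinity>) (range (\<lambda>i::int. ereal (a + of_int i * h))))"

text \<open>
  The span is the largest \<open>h\<close> for which the support fits on a lattice with some offset.  The
  offset must be allowed to vary here: a variable uniform on \<open>{0, 2}\<close> has span 2, although 1 is
  the largest spacing compatible with the offset 1.
\<close>

definition lattice_distribution :: "'a measure \<Rightarrow> ('a \<Rightarrow> ereal) \<Rightarrow> real \<Rightarrow> real \<Rightarrow> bool" where
  "lattice_distribution M V h a \<longleftrightarrow>
     \<not> (\<exists>v. AE \<omega> in M. V \<omega> \<in> {-\<infinity>, ereal v}) \<and>
     h > 0 \<and> on_lattice M V h a \<and>
     (\<forall>h' a'. on_lattice M V h' a' \<longrightarrow> h' \<le> h)"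

definition channel_lattice :: "'x pmf \<Rightarrow> ('x \<Rightarrow> 'y pmf) \<Rightarrow> real \<Rightarrow> bool" where
  "channel_lattice P W h \<longleftrightarrow>
     (\<exists>a. lattice_distribution (measure_pmf (pair_pmf (channel_joint P W) P))
            (\<lambda>((x, y), x'). nu W x y x') h a)"

definition rate_lattice :: "'x pmf \<Rightarrow> ('x \<Rightarrow> 'y pmf) \<Rightarrow> real \<Rightarrow> real \<Rightarrow> real \<Rightarrow> bool" where
  "rate_lattice P W R h a \<longleftrightarrow>
     lattice_distribution (measure_pmf (channel_joint P W))
       (\<lambda>(x, y). ereal (Z P W (eta P W R) x y)) h a"

definition pseudo_symmetric :: "'x pmf \<Rightarrow> ('x \<Rightarrow> 'y pmf) \<Rightarrow> real \<Rightarrow> bool" where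
  "pseudo_symmetric P W R \<longleftrightarrow>
     (\<exists>m b. AE (x, y) in measure_pmf (channel_joint P W).
        Z' P W (eta P W R) x y = m * Z P W (eta P W R) x y + b)"

end

(* Since the columns are permutations of each other, C(l) = (sum over x of W(y|x)^l) does not
   depend on y.  As P is uniform, Z(l) = ln (C(l) / |X|) - l * ln W(Y|X) almost surely, so Z and Z'
   are both affine functions of ln W(Y|X).  Every column carries all the nonzero entries of W, so
   the finite values of nu are exactly the differences of logarithms of nonzero entries; they lie
   in h * \<int> iff the values of Z(\<eta>) lie in a coset of \<eta> * h * \<int>.
   That \<eta> > 0 needs the minimizer \<rho> to exist: the objective extends continuously to
   \<alpha> = 0 with value 0 and derivative R - I(X;Y) < 0 there. *)

theory Submission
  imports Defs
begin

section \<open>Joint law of input and output, and minimizers over half-open intervals\<close>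

lemma pmf_channel_joint:
  fixes P :: "'x::finite pmf" and W :: "'x \<Rightarrow> 'y::finite pmf"
  shows "pmf (channel_joint P W) (x, y) = pmf P x * pmf (W x) y"
proof -
  have "pmf (map_pmf (Pair x') (W x')) (x, y) = (if x' = x then pmf (W x) y else 0)" for x'
  proof (cases "x' = x")
    case True
    then show ?thesis by (simp add: pmf_map_inj' inj_on_def)
  next
    case False
    then show ?thesis by (auto simp: pmf_eq_0_set_pmf)
  qed
  then show ?thesis
    by (simp add: channel_joint_def pmf_bind integral_measure_pmf_real[where A = UNIV]
        if_distrib[of "\<lambda>u. u * _"] cong: if_cong)
qed

text \<open>\<open>arg_min_on\<close> is a choice operator, so nothing is known about its value
  until some minimizer is exhibited; \<open>x\<close> is such a witness.\<close>

lemma arg_min_on_in: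
  fixes f :: "'a \<Rightarrow> 'b::linorder"
  assumes "x \<in> S" "\<And>y. y \<in> S \<Longrightarrow> f x \<le> f y"
  shows "arg_min_on f S \<in> S"
proof -
  have "is_arg_min f (\<lambda>x. x \<in> S) x"
    using assms by (auto simp: is_arg_min_linorder)
  then have "is_arg_min f (\<lambda>x. x \<in> S) (arg_min_on f S)"
    unfolding arg_min_on_def arg_min_def by (rule someI)
  then show ?thesis by (simp add: is_arg_min_def)
qed

text \<open>The interval is not compact, so the minimum is taken for the extension \<open>g\<close>
  on the closed interval; the negative slope at 0 keeps the minimizer away from the added
  endpoint.\<close>

lemma arg_min_on_in_Ioc:
  fixes f g :: "real \<Rightarrow> real"
  assumes "0 < b" and cont: "continuous_on {0..b} g"
    and der: "(g has_real_derivative d) (at 0)" and "d < 0"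
    and eq: "\<And>x. x \<in> {0<..b} \<Longrightarrow> f x = g x"
  shows "arg_min_on f {0<..b} \<in> {0<..b}"
proof -
  obtain x0 where x0: "x0 \<in> {0..b}" "\<And>x. x \<in> {0..b} \<Longrightarrow> g x0 \<le> g x"
    using continuous_attains_inf[OF _ _ cont] \<open>0 < b\<close> by fastforce
  obtain e where e: "e > 0" "\<And>t. 0 < t \<Longrightarrow> t < e \<Longrightarrow> g (0 + t) < g 0"
    using DERIV_neg_dec_right[OF der \<open>d < 0\<close>] by auto
  \<comment> \<open>Small enough for the decrease of \<open>g\<close> to the right of 0, and still
    inside the interval.\<close>
  define t where "t = min (e / 2) b"
  have "0 < t" "t < e" "t \<le> b" using e \<open>0 < b\<close> by (auto simp: t_def)
  then have "g t < g 0" using e(2)[of t] by simp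
  then have "x0 \<noteq> 0" using x0(2)[of t] \<open>0 < t\<close> \<open>t \<le> b\<close> by auto
  then have "x0 \<in> {0<..b}" using x0(1) by auto
  then show ?thesis
    by (rule arg_min_on_in) (use x0(2) eq \<open>x0 \<in> {0<..b}\<close> in auto)
qed

section \<open>Power sums of a column\<close>

locale column_symmetric =
  fixes W :: "'x::finite \<Rightarrow> 'y::finite pmf"
  assumes columns: "\<exists>\<pi>. bij \<pi> \<and> (\<forall>x. pmf (W x) y2 = pmf (W (\<pi> x)) y1)"
begin

abbreviation P :: "'x pmf" where "P \<equiv> pmf_of_set UNIV"

text \<open>\<open>undefined\<close> serves as an arbitrary reference column; \<open>C_eq\<close>
  shows that every column gives the same sum. As \<open>0 powr l = 0\<close> even for l = 0, zero
  entries never contribute.\<close>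

definition C :: "real \<Rightarrow> real" where
  "C l = (\<Sum>x\<in>UNIV. pmf (W x) undefined powr l)"

text \<open>The derivative of \<open>C\<close>, see \<open>C_deriv\<close>.\<close>

definition D :: "real \<Rightarrow> real" where
  "D l = (\<Sum>x\<in>UNIV. pmf (W x) undefined powr l * ln (pmf (W x) undefined))"

lemma column_sum_eq:
  fixes f :: "real \<Rightarrow> real"
  shows "(\<Sum>x\<in>UNIV. f (pmf (W x) y)) = (\<Sum>x\<in>UNIV. f (pmf (W x) y'))"
proof -
  obtain \<pi> where "bij \<pi>" "\<And>x. pmf (W x) y = pmf (W (\<pi> x)) y'"
    using columns by blast
  then show ?thesis
    using sum.reindex_bij_betw[of \<pi> UNIV UNIV "\<lambda>x. f (pmf (W x) y')"] by simp
qed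

lemma C_eq: "(\<Sum>x\<in>UNIV. pmf (W x) y powr l) = C l"
  unfolding C_def by (rule column_sum_eq)

lemma D_eq: "(\<Sum>x\<in>UNIV. pmf (W x) y powr l * ln (pmf (W x) y)) = D l"
  unfolding D_def by (rule column_sum_eq)

text \<open>Double counting of the total mass of the matrix: each column sums to \<open>C 1\<close>,
  each row to 1.\<close>

lemma C_1: "real CARD('y) * C 1 = real CARD('x)"
proof -
  have "real CARD('y) * C 1 = (\<Sum>y\<in>UNIV. \<Sum>x\<in>UNIV. pmf (W x) y powr 1)"
    by (simp only: C_eq sum_constant)
  also have "\<dots> = (\<Sum>x\<in>UNIV. \<Sum>y\<in>UNIV. pmf (W x) y)"
    by (subst sum.swap) simp
  also have "\<dots> = real CARD('x)"
    by (simp add: sum_pmf_eq_1)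
  finally show ?thesis .
qed

text \<open>By \<open>C_1\<close> the reference column has a nonzero entry, and its power is
  positive for every exponent.\<close>

lemma C_pos: "C l > 0"
proof -
  have "C 1 \<noteq> 0" using C_1 by auto
  then obtain x where "pmf (W x) undefined powr 1 \<noteq> 0"
    unfolding C_def by (rule sum.not_neutral_contains_not_neutral)
  then show ?thesis
    unfolding C_def using sum_pos2[of UNIV x "\<lambda>x. pmf (W x) undefined powr l"] by simp
qed

lemma C_deriv: "(C has_real_derivative D l) (at l)"
proof -
  \<comment> \<open>For w = 0 both the function and the claimed derivative vanish
    identically.\<close>
  have "((\<lambda>l. w powr l) has_real_derivative w powr l * ln w) (at l)" if "w \<ge> 0" for w :: real
    using that by (cases "w = 0") (auto intro!: derivative_eq_intros)
  then show ?thesis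
    unfolding C_def[abs_def] D_def by (intro DERIV_sum) auto
qed

section \<open>Closed forms for \<open>Z\<close>, its derivative and the objective\<close>

lemma set_channel_joint: "(x, y) \<in> set_pmf (channel_joint P W) \<longleftrightarrow> pmf (W x) y > 0"
  by (auto simp: set_pmf_iff pmf_channel_joint less_le)

text \<open>The sum over inputs stands inside, so that column sums such as \<open>C_eq\<close> apply
  for each output.\<close>

lemma expectation_channel_joint:
  fixes f :: "'x \<times> 'y \<Rightarrow> real"
  shows "measure_pmf.expectation (channel_joint P W) f =
    (\<Sum>y\<in>UNIV. \<Sum>x\<in>UNIV. pmf (W x) y * f (x, y)) / real CARD('x)"
proof -
  have "measure_pmf.expectation (channel_joint P W) f =
      (\<Sum>(x, y)\<in>UNIV. f (x, y) * pmf (channel_joint P W) (x, y))"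
    by (subst integral_measure_pmf_real[where A = UNIV]) (auto simp: case_prod_beta)
  also have "\<dots> = (\<Sum>x\<in>UNIV. \<Sum>y\<in>UNIV. f (x, y) * pmf (channel_joint P W) (x, y))"
    by (simp add: sum.cartesian_product)
  also have "\<dots> = (\<Sum>y\<in>UNIV. \<Sum>x\<in>UNIV. f (x, y) * pmf (channel_joint P W) (x, y))"
    by (rule sum.swap)
  finally show ?thesis
    by (simp add: pmf_channel_joint sum_divide_distrib mult.commute)
qed

lemma Z_eq:
  assumes "l > 0" "pmf (W x) y > 0"
  shows "Z P W l x y = ln (C l / real CARD('x)) - l * ln (pmf (W x) y)"
proof -
  let ?w = "pmf (W x) y"
  \<comment> \<open>This covers zero entries too: l > 0 keeps \<open>ereal l * -\<infinity>\<close>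
    at -\<infinity>, so both sides are 0. The denominator is free of \<open>x'\<close> and leaves
    the expectation.\<close>
  have "exp_ext (ereal l * nu W x y x') = pmf (W x') y powr l / ?w powr l" for x'
  proof (cases "pmf (W x') y = 0")
    case True
    then show ?thesis using assms by (simp add: nu_def exp_ext_def)
  next
    case False
    then have "pmf (W x') y > 0" by (simp add: less_le)
    then show ?thesis using assms
      by (simp add: nu_def exp_ext_def ln_div powr_def exp_diff algebra_simps)
  qed
  then have "measure_pmf.expectation P (\<lambda>x'. exp_ext (ereal l * nu W x y x')) =
      (\<Sum>x'\<in>UNIV. pmf (W x') y powr l / ?w powr l) / real CARD('x)"
    by (subst integral_pmf_of_set) simp_all
  also have "\<dots> = C l / real CARD('x) / ?w powr l"
    by (simp add: sum_divide_distrib mult.commute flip: C_eq[of y])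
  finally show ?thesis
    using assms C_pos[of l] by (simp add: Z_def ln_div ln_mult ln_powr)
qed

text \<open>\<open>Z_eq\<close> holds only for positive exponents; these form an open set, which
  suffices to carry the derivative of the closed form over to \<open>Z\<close>.\<close>

lemma Z'_eq:
  assumes "l > 0" "pmf (W x) y > 0"
  shows "Z' P W l x y = D l / C l - ln (pmf (W x) y)"
proof -
  have "((\<lambda>t. ln (C t / real CARD('x)) - t * ln (pmf (W x) y))
      has_real_derivative D l / C l - ln (pmf (W x) y)) (at l)"
    using C_pos[of l] by (auto intro!: derivative_eq_intros C_deriv simp: field_simps)
  then have "((\<lambda>t. Z P W t x y) has_real_derivative D l / C l - ln (pmf (W x) y)) (at l)"
    by (rule has_field_derivative_transform_within_open[of _ _ _ "{0<..}"])
       (use assms in \<open>auto simp: Z_eq\<close>)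
  then show ?thesis
    unfolding Z'_def by (rule DERIV_imp_deriv)
qed

text \<open>The closed form of the objective. It is smooth for all \<alpha> > -1, so it has a
  two-sided derivative at 0.\<close>

definition objective_ext :: "real \<Rightarrow> real \<Rightarrow> real" where
  "objective_ext R \<alpha> = \<alpha> * R + \<alpha> * ln (C (1 / (1 + \<alpha>)) / real CARD('x))
     + ln (real CARD('y) * C (1 / (1 + \<alpha>)) / real CARD('x))"

lemma rate_objective_eq:
  assumes "\<alpha> > 0"
  shows "rate_objective P W R \<alpha> = objective_ext R \<alpha>"
proof -
  define l where "l = 1 / (1 + \<alpha>)"
  define K where "K = C l / real CARD('x)"
  \<comment> \<open>The identity makes the exponents match: the entry itself times its power
    -\<alpha> * l coming from \<open>Z_eq\<close> is its power l, so each column sums to a multiple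
    of \<open>C l\<close>.\<close>
  have l: "l > 0" "1 - \<alpha> * l = l" using assms by (auto simp: l_def field_simps)
  have K: "K > 0" using C_pos by (simp add: K_def)
  have "pmf (W x) y * exp (\<alpha> * Z P W l x y) = K powr \<alpha> * pmf (W x) y powr l" for x y
  proof (cases "pmf (W x) y = 0")
    case False
    then have w: "pmf (W x) y > 0" by (simp add: less_le)
    then have "pmf (W x) y * exp (\<alpha> * Z P W l x y) =
        exp (ln (pmf (W x) y)) * exp (\<alpha> * (ln K - l * ln (pmf (W x) y)))"
      using Z_eq[OF l(1) w] by (simp add: K_def)
    also have "\<dots> = exp (\<alpha> * ln K + (1 - \<alpha> * l) * ln (pmf (W x) y))"
      by (simp add: algebra_simps flip: exp_add)
    also have "\<dots> = K powr \<alpha> * pmf (W x) y powr l"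
      using K w unfolding l(2) by (simp add: powr_def exp_add)
    finally show ?thesis .
  qed simp
  then have "measure_pmf.expectation (channel_joint P W) (\<lambda>(x, y). exp (\<alpha> * Z P W l x y)) =
      K powr \<alpha> * (real CARD('y) * C l / real CARD('x))"
    by (simp add: expectation_channel_joint C_eq flip: sum_distrib_left)
  moreover have "ln (K powr \<alpha> * (real CARD('y) * C l / real CARD('x))) =
      \<alpha> * ln K + ln (real CARD('y) * C l / real CARD('x))"
    using K C_pos[of l] by (subst ln_mult) (auto simp: ln_powr)
  ultimately show ?thesis
    by (simp add: rate_objective_def objective_ext_def l_def K_def)
qed

section \<open>Mutual information and the location of the minimizer\<close>

lemma channel_information_eq:
  "channel_information P W = ln (real CARD('y)) + real CARD('y) / real CARD('x) * D 1"
proof -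
  let ?J = "channel_joint P W"
  let ?n = "real CARD('x)" and ?m = "real CARD('y)"
  interpret information_space "measure_pmf ?J" "exp 1"
    by unfold_locales simp
  have px: "measure (measure_pmf ?J) (fst -` {x}) = 1 / ?n" for x
  proof -
    have "map_pmf fst ?J = P"
      by (simp add: channel_joint_def map_bind_pmf pmf.map_comp o_def map_pmf_const bind_return_pmf')
    then have "pmf (map_pmf fst ?J) x = 1 / ?n" by simp
    then show ?thesis by (simp add: pmf_map)
  qed
  \<comment> \<open>The output is uniform because all columns have the same sum.\<close>
  have py: "measure (measure_pmf ?J) (snd -` {y}) = 1 / ?m" for y
  proof -
    have "map_pmf snd ?J = bind_pmf P W"
      by (simp add: channel_joint_def map_bind_pmf pmf.map_comp o_def)
    then have "measure (measure_pmf ?J) (snd -` {y}) = pmf (bind_pmf P W) y"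
      by (metis pmf_map)
    also have "\<dots> = (\<Sum>x\<in>UNIV. pmf (W x) y powr 1) / ?n"
      by (simp add: pmf_bind integral_pmf_of_set)
    also have "\<dots> = 1 / ?m"
      using C_1 unfolding C_eq by (simp add: field_simps)
    finally show ?thesis .
  qed
  have "prob_space.mutual_information (measure_pmf ?J) (exp 1) (count_space UNIV) (count_space UNIV) fst snd =
     (\<Sum>(x, y)\<in>UNIV. pmf ?J (x, y) * log (exp 1) (pmf ?J (x, y) / (1 / ?n * (1 / ?m))))"
  proof -
    have "prob_space.mutual_information (measure_pmf ?J) (exp 1) (count_space (fst ` space (measure_pmf ?J)))
       (count_space (snd ` space (measure_pmf ?J))) fst snd =
     (\<Sum>(x, y)\<in>(\<lambda>x. (fst x, snd x)) ` space (measure_pmf ?J).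
        pmf ?J (x, y) * log (exp 1) (pmf ?J (x, y) / (1 / ?n * (1 / ?m))))"
    proof (rule mutual_information_simple_distributed)
      show "simple_distributed (measure_pmf ?J) fst (\<lambda>x. 1 / ?n)"
        by (rule measure_pmf.simple_distributedI) (auto simp: simple_function_def px)
      show "simple_distributed (measure_pmf ?J) snd (\<lambda>x. 1 / ?m)"
        by (rule measure_pmf.simple_distributedI) (auto simp: simple_function_def py)
      show "simple_distributed (measure_pmf ?J) (\<lambda>x. (fst x, snd x)) (pmf ?J)"
        by (rule measure_pmf.simple_distributedI) (auto simp: simple_function_def pmf.rep_eq vimage_def)
    qed
    then show ?thesis by simp
  qed
  also have "\<dots> = (\<Sum>x\<in>UNIV. \<Sum>y\<in>UNIV. (pmf (W x) y * ln ?m + pmf (W x) y * ln (pmf (W x) y)) / ?n)"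
  proof -
    have "pmf ?J (x, y) * log (exp 1) (pmf ?J (x, y) / (1 / ?n * (1 / ?m))) =
       (pmf (W x) y * ln ?m + pmf (W x) y * ln (pmf (W x) y)) / ?n" for x y
      by (cases "pmf (W x) y = 0")
         (simp_all add: pmf_channel_joint log_def less_le ln_mult algebra_simps add_divide_distrib)
    then show ?thesis
      by (simp add: case_prod_beta UNIV_Times_UNIV[symmetric] sum.cartesian_product
            del: UNIV_Times_UNIV)
  qed
  \<comment> \<open>The first part is summed along rows, which have mass 1; the second is swapped to
    columns, with \<open>powr 1\<close> inserted so that \<open>D_eq\<close> applies.\<close>
  also have "\<dots> = (\<Sum>x\<in>UNIV. ln ?m * (\<Sum>y\<in>UNIV. pmf (W x) y)) / ?n
      + (\<Sum>y\<in>UNIV. \<Sum>x\<in>UNIV. pmf (W x) y powr 1 * ln (pmf (W x) y)) / ?n"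
    by (subst (2) sum.swap)
       (simp add: sum.distrib sum_distrib_left add_divide_distrib sum_divide_distrib mult.commute)
  \<comment> \<open>The first term is the entropy of the uniform output, the second is minus the
    conditional entropy of the output given the input.\<close>
  also have "\<dots> = ln ?m + ?m / ?n * D 1"
    unfolding D_eq by (simp add: sum_pmf_eq_1)
  finally show ?thesis by (simp add: channel_information_def)
qed

lemma objective_ext_deriv:
  assumes "\<alpha> > -1"
  shows "(objective_ext R has_real_derivative
     R + ln (C (1 / (1 + \<alpha>)) / real CARD('x))
     - D (1 / (1 + \<alpha>)) / C (1 / (1 + \<alpha>)) / (1 + \<alpha>)) (at \<alpha>)"
proof -
  let ?n = "real CARD('x)" and ?m = "real CARD('y)"
  define l where "l = 1 / (1 + \<alpha>)"
  define d where "d = D l * (- (1 / (1 + \<alpha>)\<^sup>2))"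
  have "((\<lambda>\<alpha>. 1 / (1 + \<alpha>)) has_real_derivative - (1 / (1 + \<alpha>)\<^sup>2)) (at \<alpha>)"
    using assms by (auto intro!: derivative_eq_intros simp: power2_eq_square)
  from DERIV_chain2[OF C_deriv this]
  have C': "((\<lambda>\<alpha>. C (1 / (1 + \<alpha>))) has_real_derivative d) (at \<alpha>)"
    by (simp add: d_def l_def)
  \<comment> \<open>A constant factor drops out of a logarithmic derivative; c is 1 / ?n and ?m / ?n
    for the two logarithms of the objective.\<close>
  have ln': "((\<lambda>\<alpha>. ln (c * C (1 / (1 + \<alpha>)))) has_real_derivative d / C l) (at \<alpha>)"
    if "c > 0" for c
    using DERIV_chain2[OF DERIV_ln DERIV_cmult[OF C', of c]] that C_pos[of l]
    by (simp add: l_def field_simps)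
  have "(objective_ext R has_real_derivative
      R + (ln (C l / ?n) + \<alpha> * (d / C l)) + d / C l) (at \<alpha>)"
    using DERIV_add[OF DERIV_add[OF DERIV_cmult_Id[of R] DERIV_mult[OF DERIV_ident ln'[of "1 / ?n"]]]
        ln'[of "?m / ?n"]]
    by (simp add: objective_ext_def[abs_def] l_def mult.commute add.assoc)
  \<comment> \<open>The contributions of both logarithms add up to a factor 1 + \<alpha>, which
    cancels one of the two in the denominator of \<open>d\<close>.\<close>
  moreover have "\<alpha> * (d / C l) + d / C l = - (D l / C l / (1 + \<alpha>))"
  proof -
    have "\<alpha> * (d / C l) + d / C l = (1 + \<alpha>) * d / C l"
      by (simp add: algebra_simps add_divide_distrib)
    also have "(1 + \<alpha>) * d = - (D l / (1 + \<alpha>))"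
      using assms by (simp add: d_def power2_eq_square)
    finally show ?thesis by simp
  qed
  ultimately have "(objective_ext R has_real_derivative
      R + ln (C l / ?n) - D l / C l / (1 + \<alpha>)) (at \<alpha>)"
    by (elim DERIV_cong) simp
  then show ?thesis by (simp only: l_def)
qed

lemma rho_in:
  assumes "R < channel_information P W"
  shows "rho P W R \<in> {0<..1}"
  unfolding rho_def
proof (rule arg_min_on_in_Ioc)
  show "continuous_on {0..1} (objective_ext R)"
    by (rule DERIV_continuous_on, rule has_field_derivative_at_within, rule objective_ext_deriv)
       simp
  show "(objective_ext R has_real_derivative R - channel_information P W) (at 0)"
  proof -
    \<comment> \<open>With this value, \<open>ln (C 1 / real CARD('x)) - D 1 / C 1\<close> is minus
      the mutual information.\<close>
    have C1: "C 1 = real CARD('x) / real CARD('y)" using C_1 by (simp add: field_simps)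
    show ?thesis
      using objective_ext_deriv[of 0 R]
      by (simp add: channel_information_eq C1 ln_div algebra_simps)
  qed
qed (use assms in \<open>auto simp: rate_objective_eq\<close>)

lemma eta_pos:
  assumes "R < channel_information P W"
  shows "eta P W R > 0"
  using rho_in[OF assms] by (simp add: eta_def)

section \<open>Pseudo-symmetry\<close>

lemma pseudo_symmetric:
  assumes "R < channel_information P W"
  shows "pseudo_symmetric P W R"
proof -
  let ?l = "eta P W R"
  \<comment> \<open>Slope 1 / ?l and intercept ?b result from eliminating
    \<open>ln (pmf (W x) y)\<close> between \<open>Z_eq\<close> and \<open>Z'_eq\<close>.\<close>
  let ?b = "D ?l / C ?l - ln (C ?l / real CARD('x)) / ?l"
  have "Z' P W ?l x y = 1 / ?l * Z P W ?l x y + ?b"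
    if "(x, y) \<in> set_pmf (channel_joint P W)" for x y
    using that eta_pos[OF assms] by (simp add: set_channel_joint Z_eq Z'_eq field_simps)
  then have "AE (x, y) in measure_pmf (channel_joint P W).
      Z' P W ?l x y = 1 / ?l * Z P W ?l x y + ?b"
    by (auto simp: AE_measure_pmf_iff)
  then show ?thesis unfolding pseudo_symmetric_def by blast
qed

section \<open>Lattice conditions in terms of the logarithms of the nonzero entries\<close>

definition log_entries :: "real set" where
  "log_entries = {ln (pmf (W x) y) | x y. pmf (W x) y > 0}"

lemma log_entries_nonempty: "\<exists>s. s \<in> log_entries"
proof -
  obtain z where "z \<in> set_pmf (channel_joint P W)" using set_pmf_not_empty by fast
  then show ?thesis
    by (cases z) (auto simp: set_channel_joint log_entries_def)
qed

text \<open>Two nonzero entries from anywhere in the matrix also occur in a common column, so every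
  difference of their logarithms is a value of \<open>nu\<close> with positive probability.
  \<open>Q\<close> is arbitrary in order to serve both the lattice and the degeneracy
  condition.\<close>

lemma AE_nu_iff:
  "(AE \<omega> in measure_pmf (pair_pmf (channel_joint P W) P). Q ((\<lambda>((x, y), x'). nu W x y x') \<omega>)) \<longleftrightarrow>
     (\<forall>s\<in>log_entries. \<forall>t\<in>log_entries. Q (ereal (s - t))) \<and>
     ((\<exists>x y. pmf (W x) y = 0) \<longrightarrow> Q (-\<infinity>))" (is "?L \<longleftrightarrow> ?R \<and> ?I")
proof -
  have L: "?L \<longleftrightarrow> (\<forall>x y x'. pmf (W x) y > 0 \<longrightarrow> Q (nu W x y x'))"
    by (simp add: AE_measure_pmf_iff set_channel_joint Ball_def split_paired_All)
  have nu: "nu W x y x' = ereal (ln (pmf (W x') y) - ln (pmf (W x) y))"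
    if "pmf (W x) y > 0" "pmf (W x') y > 0" for x y x'
    using that by (simp add: nu_def ln_div)
  have move: "\<exists>x'. pmf (W x') y' = pmf (W x) y" for x y y'
    using columns[of y y'] by metis
  show ?thesis
  proof (intro iffI conjI)
    assume ?L
    show ?R
    proof (intro ballI)
      fix s t assume "s \<in> log_entries" "t \<in> log_entries"
      then obtain x y x' y' where "s = ln (pmf (W x') y')" "pmf (W x') y' > 0"
        and "t = ln (pmf (W x) y)" "pmf (W x) y > 0"
        unfolding log_entries_def by blast
      then show "Q (ereal (s - t))"
        using move[of y x' y'] nu \<open>?L\<close> L by metis
    qed
    show ?I
    proof
      assume "\<exists>x y. pmf (W x) y = 0"
      then obtain x' y where 0: "pmf (W x') y = 0" by blast
      \<comment> \<open>A zero entry yields the value -\<infinity> with positive probability only if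
        its column has a positive entry as well; one is moved there from elsewhere.\<close>
      obtain x where "pmf (W x) y > 0"
        using log_entries_nonempty move[of y] unfolding log_entries_def
        by (auto, metis)
      moreover have "nu W x y x' = -\<infinity>" using 0 by (simp add: nu_def)
      ultimately show "Q (-\<infinity>)" using \<open>?L\<close> L by metis
    qed
  next
    assume RI: "?R \<and> ?I"
    have "Q (nu W x y x')" if "pmf (W x) y > 0" for x y x'
    proof (cases "pmf (W x') y = 0")
      case True
      then show ?thesis using RI by (auto simp: nu_def)
    next
      case False
      then have "pmf (W x') y > 0" by (simp add: less_le)
      then have "ln (pmf (W x') y) \<in> log_entries" "ln (pmf (W x) y) \<in> log_entries"
        using that unfolding log_entries_def by blast+
      then show ?thesis using RI nu[OF that \<open>pmf (W x') y > 0\<close>] by metis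
    qed
    then show ?L using L by blast
  qed
qed

lemma AE_Z_iff:
  assumes "l > 0"
  shows "(AE \<omega> in measure_pmf (channel_joint P W). Q ((\<lambda>(x, y). ereal (Z P W l x y)) \<omega>)) \<longleftrightarrow>
     (\<forall>s\<in>log_entries. Q (ereal (ln (C l / real CARD('x)) - l * s)))"
proof -
  have "(\<forall>x y. pmf (W x) y > 0 \<longrightarrow> Q (ereal (Z P W l x y))) \<longleftrightarrow>
      (\<forall>x y. pmf (W x) y > 0 \<longrightarrow> Q (ereal (ln (C l / real CARD('x)) - l * ln (pmf (W x) y))))"
    using Z_eq[OF assms] by simp
  also have "\<dots> \<longleftrightarrow> (\<forall>s\<in>log_entries. Q (ereal (ln (C l / real CARD('x)) - l * s)))"
    unfolding log_entries_def by blast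
  finally show ?thesis
    by (simp add: AE_measure_pmf_iff set_channel_joint Ball_def split_paired_All)
qed

text \<open>An offset-free condition to which the lattice conditions for \<open>nu\<close> and for
  \<open>Z\<close> both reduce.\<close>

definition log_lattice :: "real \<Rightarrow> bool" where
  "log_lattice h \<longleftrightarrow> (\<forall>s\<in>log_entries. \<forall>t\<in>log_entries. \<exists>i::int. s - t = of_int i * h)"

lemma on_lattice_nu:
  "(\<exists>a. on_lattice (measure_pmf (pair_pmf (channel_joint P W) P))
      (\<lambda>((x, y), x'). nu W x y x') h a) \<longleftrightarrow> log_lattice h"
  (is "(\<exists>a. ?on a) \<longleftrightarrow> _")
proof -
  have on: "?on a \<longleftrightarrow>
      (\<forall>s\<in>log_entries. \<forall>t\<in>log_entries. \<exists>i::int. s - t = a + of_int i * h)" for a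
    unfolding on_lattice_def
    by (subst AE_nu_iff[where Q = "\<lambda>v. v \<in> insert (-\<infinity>) (range (\<lambda>i::int. ereal (a + of_int i * h)))"])
       (auto simp: image_iff)
  show ?thesis
  proof
    assume "log_lattice h"
    then have "?on 0" unfolding on by (simp add: log_lattice_def)
    then show "\<exists>a. ?on a" ..
  next
    assume "\<exists>a. ?on a"
    then obtain a where a: "?on a" ..
    obtain s0 where "s0 \<in> log_entries" using log_entries_nonempty by blast
    \<comment> \<open>The value 0 of \<open>nu\<close> lies on the lattice, so the offset is itself
      a multiple of \<open>h\<close> and can be absorbed.\<close>
    then obtain i0 :: int where "s0 - s0 = a + of_int i0 * h"
      using a unfolding on by meson
    then have i0: "a = of_int (- i0) * h" by simp
    show "log_lattice h"
      unfolding log_lattice_def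
    proof (intro ballI)
      fix s t assume "s \<in> log_entries" "t \<in> log_entries"
      then obtain i :: int where "s - t = a + of_int i * h" using a unfolding on by meson
      then have "s - t = of_int (i - i0) * h" using i0 by (simp add: algebra_simps)
      then show "\<exists>i::int. s - t = of_int i * h" ..
    qed
  qed
qed

lemma on_lattice_Z:
  assumes "l > 0"
  shows "(\<exists>a. on_lattice (measure_pmf (channel_joint P W))
      (\<lambda>(x, y). ereal (Z P W l x y)) (l * h) a) \<longleftrightarrow> log_lattice h"
  (is "(\<exists>a. ?on a) \<longleftrightarrow> _")
proof -
  let ?c = "ln (C l / real CARD('x))"
  have on: "?on a \<longleftrightarrow> (\<forall>s\<in>log_entries. \<exists>i::int. ?c - l * s = a + of_int i * (l * h))" for a
    unfolding on_lattice_def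
    by (subst AE_Z_iff[OF assms,
          where Q = "\<lambda>v. v \<in> insert (-\<infinity>) (range (\<lambda>i::int. ereal (a + of_int i * (l * h))))"])
       (auto simp: image_iff)
  show ?thesis
  proof
    assume lat: "log_lattice h"
    obtain s0 where s0: "s0 \<in> log_entries" using log_entries_nonempty by blast
    \<comment> \<open>Any single value of \<open>Z\<close> may serve as the offset.\<close>
    have "?on (?c - l * s0)"
      unfolding on
    proof
      fix s assume "s \<in> log_entries"
      then obtain i :: int where "s0 - s = of_int i * h"
        using lat s0 unfolding log_lattice_def by blast
      then have "l * (s0 - s) = of_int i * (l * h)" by simp
      then have "?c - l * s = ?c - l * s0 + of_int i * (l * h)" by (simp add: algebra_simps)
      then show "\<exists>i::int. ?c - l * s = ?c - l * s0 + of_int i * (l * h)" ..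
    qed
    then show "\<exists>a. ?on a" ..
  next
    assume "\<exists>a. ?on a"
    then obtain a where a: "?on a" ..
    show "log_lattice h"
      unfolding log_lattice_def
    proof (intro ballI)
      fix s t assume "s \<in> log_entries" "t \<in> log_entries"
      then obtain i j :: int where "?c - l * s = a + of_int i * (l * h)"
        "?c - l * t = a + of_int j * (l * h)"
        using a unfolding on by meson
      then have "l * (s - t) = l * (of_int (j - i) * h)" by (simp add: algebra_simps)
      then have "s - t = of_int (j - i) * h" using assms by simp
      then show "\<exists>i::int. s - t = of_int i * h" ..
    qed
  qed
qed

text \<open>Since s - s = 0 is among the finite values, the only possible single value is 0.\<close>

lemma degenerate_nu:
  "(\<exists>v. AE \<omega> in measure_pmf (pair_pmf (channel_joint P W) P).
      (\<lambda>((x, y), x'). nu W x y x') \<omega> \<in> {-\<infinity>, ereal v}) \<longleftrightarrow>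
    (\<forall>s\<in>log_entries. \<forall>t\<in>log_entries. s = t)"
proof -
  have "(AE \<omega> in measure_pmf (pair_pmf (channel_joint P W) P).
      (\<lambda>((x, y), x'). nu W x y x') \<omega> \<in> {-\<infinity>, ereal v}) \<longleftrightarrow>
    (\<forall>s\<in>log_entries. \<forall>t\<in>log_entries. s - t = v)" for v
    by (subst AE_nu_iff[where Q = "\<lambda>u. u \<in> {-\<infinity>, ereal v}"]) simp
  moreover have "(\<exists>v. \<forall>s\<in>log_entries. \<forall>t\<in>log_entries. s - t = v) \<longleftrightarrow>
      (\<forall>s\<in>log_entries. \<forall>t\<in>log_entries. s = t)"
    by (metis diff_self eq_iff_diff_eq_0)
  ultimately show ?thesis by simp
qed

lemma degenerate_Z:
  assumes "l > 0"
  shows "(\<exists>v. AE \<omega> in measure_pmf (channel_joint P W).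
      (\<lambda>(x, y). ereal (Z P W l x y)) \<omega> \<in> {-\<infinity>, ereal v}) \<longleftrightarrow>
    (\<forall>s\<in>log_entries. \<forall>t\<in>log_entries. s = t)"
proof -
  let ?c = "ln (C l / real CARD('x))"
  have "(AE \<omega> in measure_pmf (channel_joint P W).
      (\<lambda>(x, y). ereal (Z P W l x y)) \<omega> \<in> {-\<infinity>, ereal v}) \<longleftrightarrow>
    (\<forall>s\<in>log_entries. ?c - l * s = v)" for v
    by (subst AE_Z_iff[OF assms, where Q = "\<lambda>u. u \<in> {-\<infinity>, ereal v}"]) simp
  \<comment> \<open>\<open>Z\<close> is an injective affine function of the logarithm, so one is
    constant exactly if the other is.\<close>
  moreover have "?c - l * s = ?c - l * t \<longleftrightarrow> s = t" for s t using assms by simp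
  ultimately show ?thesis
    using log_entries_nonempty by metis
qed

lemma lattice_iff:
  assumes "R < channel_information P W"
  shows "channel_lattice P W h \<longleftrightarrow> (\<exists>a. rate_lattice P W R (eta P W R * h) a)"
proof -
  define l where "l = eta P W R"
  have l: "l > 0" using eta_pos[OF assms] by (simp add: l_def)
  \<comment> \<open>The common form of both sides: non-degeneracy and maximality of the span, stated
    for the logarithms alone.\<close>
  let ?lattice = "\<not> (\<forall>s\<in>log_entries. \<forall>t\<in>log_entries. s = t) \<and>
    h > 0 \<and> log_lattice h \<and> (\<forall>h'. log_lattice h' \<longrightarrow> h' \<le> h)"
  have "channel_lattice P W h \<longleftrightarrow> ?lattice"
    unfolding channel_lattice_def lattice_distribution_def degenerate_nu
    using on_lattice_nu by blast
  moreover have "(\<exists>a. rate_lattice P W R (l * h) a) \<longleftrightarrow> ?lattice"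
  proof -
    let ?on = "on_lattice (measure_pmf (channel_joint P W)) (\<lambda>(x, y). ereal (Z P W l x y))"
    have max: "(\<forall>h' a'. ?on h' a' \<longrightarrow> h' \<le> l * h) \<longleftrightarrow> (\<forall>h'. log_lattice h' \<longrightarrow> h' \<le> h)"
    proof -
      \<comment> \<open>Every candidate span for \<open>Z\<close> is l times a real number, as l is
        nonzero; in this scaled form \<open>on_lattice_Z\<close> applies.\<close>
      have "(\<forall>h' a'. ?on h' a' \<longrightarrow> h' \<le> l * h) \<longleftrightarrow> (\<forall>h' a'. ?on (l * h') a' \<longrightarrow> l * h' \<le> l * h)"
      proof
        assume r: "\<forall>h' a'. ?on (l * h') a' \<longrightarrow> l * h' \<le> l * h"
        show "\<forall>h' a'. ?on h' a' \<longrightarrow> h' \<le> l * h"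
        proof (intro allI)
          fix h' a'
          show "?on h' a' \<longrightarrow> h' \<le> l * h"
            using r[rule_format, of "h' / l" a'] l by simp
        qed
      qed blast
      also have "\<dots> \<longleftrightarrow> (\<forall>h'. log_lattice h' \<longrightarrow> h' \<le> h)"
        using on_lattice_Z[OF l] l unfolding mult_le_cancel_left_pos[OF l] by blast
      finally show ?thesis .
    qed
    show ?thesis
      unfolding rate_lattice_def lattice_distribution_def l_def[symmetric] degenerate_Z[OF l] max
      using on_lattice_Z[OF l] l by (simp add: zero_less_mult_iff)
  qed
  ultimately show ?thesis by (simp add: l_def)
qed

end

theorem proposition1:
  fixes P :: "'x::finite pmf" and W :: "'x \<Rightarrow> 'y::finite pmf" and R :: real
  assumes "P = pmf_of_set UNIV"
    and "strongly_symmetric W"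
    and "0 < R" and "R < channel_information P W"
  shows "pseudo_symmetric P W R \<and>
    (\<forall>h. channel_lattice P W h \<longleftrightarrow> (\<exists>a. rate_lattice P W R (eta P W R * h) a))"
proof -
  interpret column_symmetric W
    using assms(2) by unfold_locales (simp add: strongly_symmetric_def)
  show ?thesis
    using assms(4) pseudo_symmetric lattice_iff unfolding assms(1) by blast
qed

end
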